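(* Let $\pi \in \mathcal{P}(\mathcal{X})$ be of product form and let $P \in \mathcal{L}(\mathcal{X})$ be $\pi$-stationary. Then the map $2^{\{1,\ldots,d\}} \ni S \mapsto D(P^{(S)} \| \Pi^{(S)})$ is supermodular.
   Context: Let $d \in \mathbb{N}$ and let $\mathcal{X} = \mathcal{X}^{(1)} \times \cdots \times \mathcal{X}^{(d)}$ be a finite product state space. For $S \subseteq \{1,\ldots,d\}$ write $\mathcal{X}^{(S)} = \prod_{i \in S} \mathcal{X}^{(i)}$. $\mathcal{L}(\mathcal{Y})$ is the set of transition (row-stochastic) matrices on a finite set $\mathcal{Y}$; $\mathcal{P}(\mathcal{X})$ is the set of probability masses $\pi$ on $\mathcal{X}$ with $\min_x \pi(x) > 0$. $P$ is $\pi$-stationary if $\pi P = \pi$. $\pi^{(S)}$ is the marginal of $\pi$ on $\mathcal{X}^{(S)}$. $\pi$ is of product form if $\pi(x)=\prod_{i=1}^d \pi_i(x^i)$ for some probability masses $\pi_i$ on $\mathcal{X}^{(i)}$. $\Pi$ is the transition matrix each of whose rows is $\pi$. For a $\pi$-stationary matrix $P$, the keep-$S$-in matrix $P^{(S)} \in \mathcal{L}(\mathcal{X}^{(S)})$ is $$P^{(S)}(x^{(S)},y^{(S)}) = \frac{\sum_{u,v \in \mathcal{X}^{(\{1,\ldots,d\}\setminus S)}} \pi(x^{(S)},u) P((x^{(S)},u),(y^{(S)},v))}{\pi^{(S)}(x^{(S)})},$$ with $P^{(\emptyset)} = 1$; $\Pi^{(S)}$ is defined likewise (its rows all equal $\pi^{(S)}$).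 Here $D(P^{(S)}\|\Pi^{(S)}) = \sum_{x}\pi^{(S)}(x)\sum_y P^{(S)}(x,y)\ln\frac{P^{(S)}(x,y)}{\Pi^{(S)}(x,y)}$ with $0\ln\frac0a=0$. A set function $f: 2^U \to \mathbb{R}$ is submodular if $f(S)+f(T) \ge f(S\cap T)+f(S\cup T)$ for all $S,T\subseteq U$, and supermodular if $-f$ is submodular. *)

theory Defs
  imports "HOL-Analysis.Analysis"
begin

text \<open>
  The coordinate spaces \<open>X i\<close>, \<open>i \<in> {1..d}\<close>, are finite sets of a common type. Points of a product
  over \<open>S\<close> are extensional functions, so \<open>(x\<^sup>S, u)\<close> is the library's \<open>merge\<close>. Masses and matrices
  are real-valued functions that matter only on the relevant state space.
\<close>

definition states :: "(nat \<Rightarrow> 'a set) \<Rightarrow> nat set \<Rightarrow> (nat \<Rightarrow> 'a) set" where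
  "states X S = (\<Pi>\<^sub>E i\<in>S. X i)"

definition prob_mass :: "'s set \<Rightarrow> ('s \<Rightarrow> real) \<Rightarrow> bool" where
  "prob_mass Y p \<longleftrightarrow> (\<forall>x\<in>Y. p x \<ge> 0) \<and> (\<Sum>x\<in>Y. p x) = 1"

definition pos_prob_mass :: "'s set \<Rightarrow> ('s \<Rightarrow> real) \<Rightarrow> bool" where
  "pos_prob_mass Y p \<longleftrightarrow> prob_mass Y p \<and> (\<forall>x\<in>Y. p x > 0)"

definition transition_matrix :: "'s set \<Rightarrow> ('s \<Rightarrow> 's \<Rightarrow> real) \<Rightarrow> bool" where
  "transition_matrix Y P \<longleftrightarrow> (\<forall>x\<in>Y. prob_mass Y (P x))"

definition stationary :: "'s set \<Rightarrow> ('s \<Rightarrow> real) \<Rightarrow> ('s \<Rightarrow> 's \<Rightarrow> real) \<Rightarrow> bool" where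
  "stationary Y p P \<longleftrightarrow> (\<forall>y\<in>Y. (\<Sum>x\<in>Y. p x * P x y) = p y)"

definition product_form :: "nat \<Rightarrow> (nat \<Rightarrow> 'a set) \<Rightarrow> ((nat \<Rightarrow> 'a) \<Rightarrow> real) \<Rightarrow> bool" where
  "product_form d X p \<longleftrightarrow>
     (\<exists>q. (\<forall>i\<in>{1..d}. prob_mass (X i) (q i)) \<and>
          (\<forall>x\<in>states X {1..d}. p x = (\<Prod>i\<in>{1..d}. q i (x i))))"

definition marginal ::
  "nat \<Rightarrow> (nat \<Rightarrow> 'a set) \<Rightarrow> ((nat \<Rightarrow> 'a) \<Rightarrow> real) \<Rightarrow> nat set \<Rightarrow> (nat \<Rightarrow> 'a) \<Rightarrow> real" where
  "marginal d X p S x = (\<Sum>u\<in>states X ({1..d} - S). p (merge S ({1..d} - S) (x, u)))"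

definition keep_in ::
  "nat \<Rightarrow> (nat \<Rightarrow> 'a set) \<Rightarrow> ((nat \<Rightarrow> 'a) \<Rightarrow> real) \<Rightarrow> ((nat \<Rightarrow> 'a) \<Rightarrow> (nat \<Rightarrow> 'a) \<Rightarrow> real)
     \<Rightarrow> nat set \<Rightarrow> (nat \<Rightarrow> 'a) \<Rightarrow> (nat \<Rightarrow> 'a) \<Rightarrow> real" where
  "keep_in d X p P S x y =
     (\<Sum>u\<in>states X ({1..d} - S). \<Sum>v\<in>states X ({1..d} - S).
        p (merge S ({1..d} - S) (x, u))
          * P (merge S ({1..d} - S) (x, u)) (merge S ({1..d} - S) (y, v)))
     / marginal d X p S x"

definition stationary_matrix :: "('s \<Rightarrow> real) \<Rightarrow> 's \<Rightarrow> 's \<Rightarrow> real" where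
  "stationary_matrix p = (\<lambda>x y. p y)"

text \<open>
  No case distinction is needed for \<open>0 ln (0 / a) = 0\<close>, as \<open>0 * ln (0 / a) = 0\<close> in HOL. The case
  \<open>M x y > 0 = L x y\<close>, where the divergence is infinite, is not modelled: it cannot occur when \<open>L\<close>
  is a keep-in matrix of \<open>stationary_matrix p\<close> for a positive \<open>p\<close>.
\<close>
definition KL_div ::
  "'s set \<Rightarrow> ('s \<Rightarrow> real) \<Rightarrow> ('s \<Rightarrow> 's \<Rightarrow> real) \<Rightarrow> ('s \<Rightarrow> 's \<Rightarrow> real) \<Rightarrow> real" where
  "KL_div Y p M L = (\<Sum>x\<in>Y. p x * (\<Sum>y\<in>Y. M x y * ln (M x y / L x y)))"

definition submodular :: "'u set \<Rightarrow> ('u set \<Rightarrow> real) \<Rightarrow> bool" where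
  "submodular U f \<longleftrightarrow> (\<forall>S T. S \<subseteq> U \<longrightarrow> T \<subseteq> U \<longrightarrow> f S + f T \<ge> f (S \<inter> T) + f (S \<union> T))"

definition supermodular :: "'u set \<Rightarrow> ('u set \<Rightarrow> real) \<Rightarrow> bool" where
  "supermodular U f \<longleftrightarrow> submodular U (\<lambda>S. - f S)"

text \<open>The convention for the empty set is already a consequence of the general formula.\<close>
lemma keep_in_empty:
  assumes p: "prob_mass (states X {1..d}) p" and P: "transition_matrix (states X {1..d}) P"
  shows "keep_in d X p P {} x y = 1"
proof -
  have m: "merge {} {1..d} (z, u) = u" if "u \<in> states X {1..d}" for z u :: "nat \<Rightarrow> 'a"
    using that by (auto simp: merge_def states_def PiE_def extensional_def fun_eq_iff)
  have "(\<Sum>u\<in>states X {1..d}. \<Sum>v\<in>states X {1..d}. p (merge {} {1..d} (x, u))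
          * P (merge {} {1..d} (x, u)) (merge {} {1..d} (y, v)))
        = (\<Sum>u\<in>states X {1..d}. p u * (\<Sum>v\<in>states X {1..d}. P u v))"
    unfolding sum_distrib_left by (intro sum.cong refl) (simp only: m)
  also have "\<dots> = (\<Sum>u\<in>states X {1..d}. p u)"
    using P by (intro sum.cong) (auto simp: transition_matrix_def prob_mass_def)
  finally have num: "(\<Sum>u\<in>states X {1..d}. \<Sum>v\<in>states X {1..d}. p (merge {} {1..d} (x, u))
          * P (merge {} {1..d} (x, u)) (merge {} {1..d} (y, v))) = 1"
    using p by (simp add: prob_mass_def)
  have "(\<Sum>u\<in>states X {1..d}. p (merge {} {1..d} (x, u))) = (\<Sum>u\<in>states X {1..d}. p u)"
    by (intro sum.cong refl) (simp only: m)
  then have den: "(\<Sum>u\<in>states X {1..d}. p (merge {} {1..d} (x, u))) = 1"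
    using p by (simp add: prob_mass_def)
  show ?thesis
    unfolding keep_in_def marginal_def Diff_empty num den by simp
qed

end

theory Submission
  imports Defs
begin

text \<open>
  With the edge measure \<open>Q(x, y) = p(x) P(x, y)\<close> and its marginals \<open>Q\<^sub>S(x\<^sup>S, y\<^sup>S)\<close>, the divergence is
  the \<open>Q\<close>-expectation of \<open>ln Q\<^sub>S(x\<^sup>S, y\<^sup>S) - ln p\<^sub>S(x\<^sup>S) - ln p\<^sub>S(y\<^sup>S)\<close>. For \<open>p\<close> of product form the
  last two terms are modular in \<open>S\<close>, and the first one is a negative entropy, which is supermodular
  because conditional mutual information is nonnegative.
\<close>

section \<open>Fibre masses and submodularity of entropy\<close>

text \<open>The pushforward of \<open>Q\<close> under \<open>g\<close> is indexed by points of the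
  domain, not by values of \<open>g\<close>, so that entropies of functions with different ranges
  become sums over the same set \<open>A\<close>.\<close>

definition fibre_mass :: "'s set \<Rightarrow> ('s \<Rightarrow> real) \<Rightarrow> ('s \<Rightarrow> 'b) \<Rightarrow> 's \<Rightarrow> real" where
  "fibre_mass A Q g z = (\<Sum>w\<in>{w\<in>A. g w = g z}. Q w)"

lemma fibre_mass_nonneg: "(\<And>w. w \<in> A \<Longrightarrow> Q w \<ge> 0) \<Longrightarrow> fibre_mass A Q g z \<ge> 0"
  unfolding fibre_mass_def by (rule sum_nonneg) auto

lemma fibre_mass_pos:
  assumes "finite A" "\<And>w. w \<in> A \<Longrightarrow> Q w \<ge> 0" "z \<in> A" "Q z > 0"
  shows "fibre_mass A Q g z > 0"
  unfolding fibre_mass_def by (rule sum_pos2[where i = z]) (use assms in auto)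

lemma fibre_mass_cong: "g w = g z \<Longrightarrow> fibre_mass A Q g w = fibre_mass A Q g z"
  by (simp add: fibre_mass_def)

text \<open>
  Here \<open>u\<close> plays the role of the pair \<open>(a, b)\<close> and \<open>c\<close> that of a common function of \<open>a\<close> and \<open>b\<close>:
  the inequality is \<open>I(a; b | c) \<ge> 0\<close>, proved by the Gibbs argument \<open>ln r \<le> r - 1\<close>.
\<close>
lemma entropy_submodular:
  fixes Q :: "'s \<Rightarrow> real"
  assumes fin: "finite A" and Q0: "\<And>w. w \<in> A \<Longrightarrow> Q w \<ge> 0"
    and ab_u: "\<And>w z. w \<in> A \<Longrightarrow> z \<in> A \<Longrightarrow> a w = a z \<Longrightarrow> b w = b z \<Longrightarrow> u w = u z"
    and a_c: "\<And>w z. w \<in> A \<Longrightarrow> z \<in> A \<Longrightarrow> a w = a z \<Longrightarrow> c w = c z"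
    and b_c: "\<And>w z. w \<in> A \<Longrightarrow> z \<in> A \<Longrightarrow> b w = b z \<Longrightarrow> c w = c z"
  shows "(\<Sum>z\<in>A. Q z * ln (fibre_mass A Q a z)) + (\<Sum>z\<in>A. Q z * ln (fibre_mass A Q b z))
    \<le> (\<Sum>z\<in>A. Q z * ln (fibre_mass A Q c z)) + (\<Sum>z\<in>A. Q z * ln (fibre_mass A Q u z))"
proof -
  let ?m = "fibre_mass A Q"
  \<comment> \<open>Chosen so that \<open>R z * ?m a z * ?m b z\<close> is \<open>Q z\<close> times
    the ratio \<open>?r\<close> of the Gibbs argument.\<close>
  define R where "R z = Q z / (?m u z * ?m c z)" for z
  have mpos: "?m g z > 0" if "z \<in> A" "Q z > 0" for g :: "'s \<Rightarrow> 'z" and z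
    by (rule fibre_mass_pos[of A Q, OF fin _ that]) (rule Q0)
  have m0: "?m g z \<ge> 0" for g :: "'s \<Rightarrow> 'z" and z
    by (rule fibre_mass_nonneg) (rule Q0)
  have m_fibre: "?m g z = (\<Sum>w\<in>A. if g w = g z then Q w else 0)" for g :: "'s \<Rightarrow> 'z" and z
    unfolding fibre_mass_def by (rule sum.inter_filter[OF fin])
  \<comment> \<open>Both \<open>u\<close> and \<open>c\<close> are constant on a joint fibre of
    \<open>a\<close> and \<open>b\<close>, which lies inside one fibre of \<open>u\<close>. A
    nonempty joint fibre also forces \<open>c w = c w'\<close>.\<close>
  have inner: "(\<Sum>z\<in>{z\<in>A. a z = a w \<and> b z = b w'}. R z) \<le> (if c w = c w' then 1 / ?m c w else 0)"
    if w: "w \<in> A" and w': "w' \<in> A" for w w'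
  proof (cases "\<exists>z\<in>A. a z = a w \<and> b z = b w'")
    case True
    then obtain z0 where z0: "z0 \<in> A" "a z0 = a w" "b z0 = b w'" by blast
    let ?Z = "{z\<in>A. a z = a w \<and> b z = b w'}"
    have cw: "c w = c w'"
      using a_c[OF z0(1) w z0(2)] b_c[OF z0(1) w' z0(3)] by simp
    have R_eq: "R z = Q z / (?m u z0 * ?m c w)" if "z \<in> ?Z" for z
    proof -
      have "u z = u z0" using ab_u[of z z0] that z0 by auto
      moreover have "c z = c w" using a_c[of z w] that w by auto
      ultimately show ?thesis unfolding R_def by (metis fibre_mass_cong)
    qed
    have "(\<Sum>z\<in>?Z. R z) = (\<Sum>z\<in>?Z. Q z) / (?m u z0 * ?m c w)"
      using R_eq by (simp add: sum_divide_distrib)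
    also have "\<dots> \<le> ?m u z0 / (?m u z0 * ?m c w)"
    proof (rule divide_right_mono)
      show "(\<Sum>z\<in>?Z. Q z) \<le> ?m u z0"
        unfolding fibre_mass_def
      proof (rule sum_mono2)
        show "?Z \<subseteq> {z\<in>A. u z = u z0}"
          using ab_u[OF _ z0(1)] z0(2,3) by fastforce
      qed (use fin Q0 in auto)
    qed (simp add: m0)
    \<comment> \<open>If \<open>?m u z0 = 0\<close>, the left side is a division by zero, hence
      0.\<close>
    also have "\<dots> \<le> 1 / ?m c w"
      using m0[of c w] by (cases "?m u z0 = 0") auto
    finally show ?thesis using cw by simp
  next
    case False
    then have "{z\<in>A. a z = a w \<and> b z = b w'} = {}" by auto
    then show ?thesis using m0[of c w] by (simp only: sum.empty) simp
  qed
  \<comment> \<open>The two fibre masses are expanded into sums over independent points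
    \<open>w\<close> and \<open>w'\<close>. Summing over \<open>z\<close> first then exposes the
    sums that \<open>inner\<close> bounds.\<close>
  have "(\<Sum>z\<in>A. R z * ?m a z * ?m b z)
      = (\<Sum>z\<in>A. \<Sum>w\<in>A. \<Sum>w'\<in>A. Q w * Q w' * (if a z = a w \<and> b z = b w' then R z else 0))"
    unfolding m_fibre[of a] m_fibre[of b] mult.assoc sum_product unfolding sum_distrib_left
    by (intro sum.cong refl) auto
  also have "\<dots> = (\<Sum>w\<in>A. \<Sum>w'\<in>A. \<Sum>z\<in>A. Q w * Q w' * (if a z = a w \<and> b z = b w' then R z else 0))"
    by (subst sum.swap, rule sum.cong[OF refl], rule sum.swap)
  also have "\<dots> = (\<Sum>w\<in>A. \<Sum>w'\<in>A. Q w * Q w' * (\<Sum>z\<in>{z\<in>A. a z = a w \<and> b z = b w'}. R z))"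
    by (intro sum.cong refl) (simp add: sum_distrib_left[symmetric] sum.inter_filter[OF fin])
  also have "\<dots> \<le> (\<Sum>w\<in>A. \<Sum>w'\<in>A. Q w * Q w' * (if c w = c w' then 1 / ?m c w else 0))"
    by (intro sum_mono mult_left_mono inner) (auto simp: Q0)
  also have "\<dots> = (\<Sum>w\<in>A. Q w / ?m c w * ?m c w)"
    unfolding m_fibre[of c] sum_distrib_left by (intro sum.cong refl) auto
  \<comment> \<open>Each summand is \<open>Q w\<close>, or 0 if \<open>?m c w = 0\<close>.\<close>
  also have "\<dots> \<le> (\<Sum>w\<in>A. Q w)"
    by (intro sum_mono) (auto simp: Q0)
  finally have le: "(\<Sum>z\<in>A. R z * ?m a z * ?m b z) \<le> (\<Sum>z\<in>A. Q z)" .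
  have "0 \<le> (\<Sum>z\<in>A. Q z - R z * ?m a z * ?m b z)"
    using le by (simp add: sum_subtractf)
  also have "\<dots> \<le> (\<Sum>z\<in>A. Q z * (ln (?m c z) + ln (?m u z) - ln (?m a z) - ln (?m b z)))"
  proof (rule sum_mono)
    fix z assume z: "z \<in> A"
    show "Q z - R z * ?m a z * ?m b z \<le> Q z * (ln (?m c z) + ln (?m u z) - ln (?m a z) - ln (?m b z))"
    proof (cases "Q z = 0")
      case False
      then have Qz: "Q z > 0" using Q0[OF z] by simp
      let ?r = "?m a z * ?m b z / (?m u z * ?m c z)"
      have "ln ?r \<le> ?r - 1"
        by (rule ln_le_minus_one) (simp add: mpos[OF z Qz])
      moreover have "ln ?r = ln (?m a z) + ln (?m b z) - ln (?m u z) - ln (?m c z)"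
        by (simp add: ln_mult ln_div mpos[OF z Qz] less_imp_neq[THEN not_sym])
      ultimately have "1 - ?r \<le> ln (?m c z) + ln (?m u z) - ln (?m a z) - ln (?m b z)"
        by linarith
      from mult_left_mono[OF this, of "Q z"] Qz show ?thesis
        by (simp add: R_def right_diff_distrib)
    qed (simp add: R_def)
  qed
  finally show ?thesis
    by (simp add: algebra_simps sum.distrib sum_subtractf)
qed

section \<open>Product state spaces and marginals\<close>

lemma finite_states: "S \<subseteq> I \<Longrightarrow> finite I \<Longrightarrow> (\<And>i. i \<in> I \<Longrightarrow> finite (X i)) \<Longrightarrow> finite (states X S)"
  unfolding states_def by (rule finite_PiE) (auto intro: finite_subset)

lemma restrict_in_states: "x \<in> states X I \<Longrightarrow> S \<subseteq> I \<Longrightarrow> restrict x S \<in> states X S"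
  by (auto simp: states_def)

text \<open>Extensionality makes \<open>merge\<close> and \<open>restrict\<close> mutually inverse
  here. This turns marginals and keep-in matrices into sums over fibres of the restriction to
  \<open>S\<close>.\<close>

lemma sum_merge_states:
  assumes "S \<subseteq> I" "s \<in> states X S"
  shows "(\<Sum>u\<in>states X (I - S). f (merge S (I - S) (s, u)))
    = (\<Sum>x\<in>{x\<in>states X I. restrict x S = s}. f x)"
proof (rule sum.reindex_bij_witness[where
      i = "\<lambda>x. restrict x (I - S)" and j = "\<lambda>u. merge S (I - S) (s, u)"])
  fix u assume u: "u \<in> states X (I - S)"
  show "restrict (merge S (I - S) (s, u)) (I - S) = u"
    using u by (auto simp: states_def merge_def fun_eq_iff PiE_def extensional_def)
  have "merge S (I - S) (s, u) \<in> states X I"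
    using u assms by (auto simp: states_def merge_def PiE_def extensional_def Pi_def)
  moreover have "restrict (merge S (I - S) (s, u)) S = s"
    using assms by (auto simp: states_def merge_def fun_eq_iff PiE_def extensional_def)
  ultimately show "merge S (I - S) (s, u) \<in> {x\<in>states X I. restrict x S = s}" by simp
next
  fix x assume x: "x \<in> {x\<in>states X I. restrict x S = s}"
  then show "restrict x (I - S) \<in> states X (I - S)"
    by (auto simp: restrict_in_states)
  from x have "x \<in> states X I" "s = restrict x S" by auto
  then show "merge S (I - S) (s, restrict x (I - S)) = x"
    using assms(1) by (auto simp: states_def merge_def fun_eq_iff PiE_def extensional_def)
qed simp

text \<open>The factors with index in \<open>S\<close> leave the sum, and the remaining sum of
  products is a product of total masses, each equal to 1.\<close>

lemma marginal_product_form: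
  assumes fin: "\<And>i. i \<in> {1..d} \<Longrightarrow> finite (X i)"
    and q: "\<And>i. i \<in> {1..d} \<Longrightarrow> prob_mass (X i) (q i)"
    and p: "\<And>x. x \<in> states X {1..d} \<Longrightarrow> p x = (\<Prod>i\<in>{1..d}. q i (x i))"
    and S: "S \<subseteq> {1..d}" and s: "s \<in> states X S"
  shows "marginal d X p S s = (\<Prod>i\<in>S. q i (s i))"
proof -
  let ?I = "{1..d}"
  have "p (merge S (?I - S) (s, u)) = (\<Prod>i\<in>S. q i (s i)) * (\<Prod>i\<in>?I - S. q i (u i))"
    if u: "u \<in> states X (?I - S)" for u
  proof -
    let ?x = "merge S (?I - S) (s, u)"
    have "?x \<in> states X ?I"
      using u s S by (auto simp: states_def merge_def PiE_def extensional_def Pi_def)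
    then have "p ?x = (\<Prod>i\<in>?I - S. q i (?x i)) * (\<Prod>i\<in>S. q i (?x i))"
      using prod.subset_diff[OF S, of "\<lambda>i. q i (?x i)"] by (simp add: p)
    moreover have "(\<Prod>i\<in>?I - S. q i (?x i)) = (\<Prod>i\<in>?I - S. q i (u i))"
      "(\<Prod>i\<in>S. q i (?x i)) = (\<Prod>i\<in>S. q i (s i))"
      by (auto intro!: prod.cong simp: merge_def)
    ultimately show ?thesis by (simp only: mult.commute)
  qed
  then have "marginal d X p S s
      = (\<Prod>i\<in>S. q i (s i)) * (\<Sum>u\<in>states X (?I - S). \<Prod>i\<in>?I - S. q i (u i))"
    by (simp add: marginal_def sum_distrib_left)
  also have "(\<Sum>u\<in>states X (?I - S). \<Prod>i\<in>?I - S. q i (u i)) = (\<Prod>i\<in>?I - S. \<Sum>y\<in>X i. q i y)"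
    unfolding states_def by (subst prod_sum_PiE) (auto simp: fin)
  also have "\<dots> = 1"
    by (rule prod.neutral) (use q in \<open>auto simp: prob_mass_def\<close>)
  finally show ?thesis by simp
qed

section \<open>The divergence as an expectation under the edge measure\<close>

definition restrict_pair ::
  "nat set \<Rightarrow> (nat \<Rightarrow> 'a) \<times> (nat \<Rightarrow> 'a) \<Rightarrow> (nat \<Rightarrow> 'a) \<times> (nat \<Rightarrow> 'a)" where
  "restrict_pair S = (\<lambda>(x, y). (restrict x S, restrict y S))"

lemma restrict_pair_mono:
  "S \<subseteq> T \<Longrightarrow> restrict_pair T w = restrict_pair T z
    \<Longrightarrow> restrict_pair S w = restrict_pair S z"
  by (auto simp: restrict_pair_def restrict_def fun_eq_iff split: prod.splits) (metis subsetD)+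

lemma restrict_pair_Un:
  "restrict_pair S w = restrict_pair S z \<Longrightarrow> restrict_pair T w = restrict_pair T z
    \<Longrightarrow> restrict_pair (S \<union> T) w = restrict_pair (S \<union> T) z"
  by (auto simp: restrict_pair_def restrict_def fun_eq_iff split: prod.splits) metis+

lemma sum_fibres_states:
  assumes "finite (states X I)" "finite (states X S)" "S \<subseteq> I"
  shows "(\<Sum>s\<in>states X S. \<Sum>x\<in>{x\<in>states X I. restrict x S = s}. f s x)
    = (\<Sum>x\<in>states X I. f (restrict x S) x)"
proof -
  have "(\<Sum>s\<in>states X S. \<Sum>x\<in>{x\<in>states X I. restrict x S = s}. f s x)
      = (\<Sum>s\<in>states X S. \<Sum>x\<in>{x\<in>states X I. restrict x S = s}. f (restrict x S) x)"
    by (intro sum.cong refl) auto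
  also have "\<dots> = (\<Sum>x\<in>states X I. f (restrict x S) x)"
    using assms restrict_in_states by (intro sum.group) fastforce+
  finally show ?thesis .
qed

text \<open>The weight \<open>marginal d X p S s\<close> cancels the denominator of the keep-in
  matrix. What remains is a sum over \<open>S\<close>-states of block masses of \<open>Q\<close>,
  which unfolds into a sum over all pairs of full states.\<close>

lemma KL_div_keep_in:
  fixes X :: "nat \<Rightarrow> 'a set"
  assumes fin: "\<And>i. i \<in> {1..d} \<Longrightarrow> finite (X i)"
    and p: "pos_prob_mass (states X {1..d}) p"
    and P: "transition_matrix (states X {1..d}) P"
    and marg: "\<And>s. s \<in> states X S \<Longrightarrow> marginal d X p S s > 0"
    and S: "S \<subseteq> {1..d}"
  defines "A \<equiv> states X {1..d} \<times> states X {1..d}"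
    and "Q \<equiv> \<lambda>(x, y). p x * P x y"
  shows "KL_div (states X S) (marginal d X p S)
       (keep_in d X p P S) (keep_in d X p (stationary_matrix p) S)
    = (\<Sum>z\<in>A. Q z * (ln (fibre_mass A Q (restrict_pair S) z)
         - (ln (marginal d X p S (restrict (fst z) S)) + ln (marginal d X p S (restrict (snd z) S)))))"
proof -
  let ?I = "{1..d}"
  let ?m = "marginal d X p S"
  define F where "F s = {x\<in>states X ?I. restrict x S = s}" for s
  define N where "N s t = (\<Sum>x\<in>F s. \<Sum>y\<in>F t. p x * P x y)" for s t
  have finI: "finite (states X ?I)" and finS: "finite (states X S)"
    using finite_states[of _ ?I X] fin S by auto
  have Q0: "Q z \<ge> 0" if "z \<in> A" for z
    using that p P by (force simp: A_def Q_def pos_prob_mass_def transition_matrix_def prob_mass_def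
        intro!: mult_nonneg_nonneg)
  have m_eq: "?m s = (\<Sum>x\<in>F s. p x)" if "s \<in> states X S" for s
    unfolding marginal_def F_def by (rule sum_merge_states[OF S that])
  have keep: "keep_in d X p M S s t = (\<Sum>x\<in>F s. \<Sum>y\<in>F t. p x * M x y) / ?m s"
    if "s \<in> states X S" "t \<in> states X S" for M s t
    unfolding keep_in_def F_def
      sum_merge_states[OF S that(2), where f = "\<lambda>y. p x * M x y" for x]
      sum_merge_states[OF S that(1),
        where f = "\<lambda>x. \<Sum>y\<in>{y\<in>states X ?I. restrict y S = t}. p x * M x y"] ..
  \<comment> \<open>The double sum of \<open>p x * p y\<close> over two fibres factors as
    \<open>?m s * ?m t\<close>; positivity of \<open>?m s\<close> allows the cancellation.\<close>
  have keep_st: "keep_in d X p (stationary_matrix p) S s t = ?m t"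
    if "s \<in> states X S" "t \<in> states X S" for s t
    using marg[OF that(1)]
    by (simp add: keep[OF that] stationary_matrix_def sum_product[symmetric] m_eq[OF that(1), symmetric]
        m_eq[OF that(2), symmetric])
  \<comment> \<open>A fibre of \<open>restrict_pair S\<close> is a rectangle of two fibres of the
    restriction.\<close>
  have N_eq: "N (restrict x S) (restrict y S) = fibre_mass A Q (restrict_pair S) (x, y)" for x y
  proof -
    have "{w\<in>A. restrict_pair S w = restrict_pair S (x, y)} = F (restrict x S) \<times> F (restrict y S)"
      by (auto simp: A_def F_def restrict_pair_def)
    then show ?thesis
      by (simp add: fibre_mass_def N_def sum.cartesian_product Q_def)
  qed
  have "KL_div (states X S) ?m (keep_in d X p P S) (keep_in d X p (stationary_matrix p) S)
      = (\<Sum>s\<in>states X S. \<Sum>t\<in>states X S. N s t * ln (N s t / ?m s / ?m t))"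
    unfolding KL_div_def sum_distrib_left
  proof (intro sum.cong refl)
    fix s t assume st: "s \<in> states X S" "t \<in> states X S"
    show "?m s * (keep_in d X p P S s t
        * ln (keep_in d X p P S s t / keep_in d X p (stationary_matrix p) S s t))
      = N s t * ln (N s t / ?m s / ?m t)"
      using marg[OF st(1)] unfolding keep_st[OF st] keep[OF st, of P] N_def[symmetric] by simp
  qed
  \<comment> \<open>The factor \<open>N s t\<close> in front of the logarithm is expanded, and the
    sums are reordered so that each of \<open>s\<close> and \<open>t\<close> stands next to the sum
    over its own fibre.\<close>
  also have "\<dots> = (\<Sum>s\<in>states X S. \<Sum>x\<in>F s. \<Sum>t\<in>states X S. \<Sum>y\<in>F t.
      p x * P x y * ln (N s t / ?m s / ?m t))"
  proof (rule sum.cong[OF refl])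
    fix s
    have "N s t * l = (\<Sum>x\<in>F s. \<Sum>y\<in>F t. p x * P x y * l)" for t l
      by (simp add: N_def sum_distrib_right)
    then show "(\<Sum>t\<in>states X S. N s t * ln (N s t / ?m s / ?m t))
      = (\<Sum>x\<in>F s. \<Sum>t\<in>states X S. \<Sum>y\<in>F t. p x * P x y * ln (N s t / ?m s / ?m t))"
      by (simp only:) (rule sum.swap)
  qed
  also have "\<dots> = (\<Sum>x\<in>states X ?I. \<Sum>y\<in>states X ?I. p x * P x y
      * ln (N (restrict x S) (restrict y S) / ?m (restrict x S) / ?m (restrict y S)))"
    unfolding F_def by (simp only: sum_fibres_states[OF finI finS S])
  also have "\<dots> = (\<Sum>z\<in>A. Q z * ln (fibre_mass A Q (restrict_pair S) z
      / ?m (restrict (fst z) S) / ?m (restrict (snd z) S)))"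
    by (simp add: N_eq A_def Q_def sum.cartesian_product case_prod_unfold)
  also have "\<dots> = (\<Sum>z\<in>A. Q z * (ln (fibre_mass A Q (restrict_pair S) z)
         - (ln (?m (restrict (fst z) S)) + ln (?m (restrict (snd z) S)))))"
  proof (rule sum.cong[OF refl])
    fix z assume z: "z \<in> A"
    show "Q z * ln (fibre_mass A Q (restrict_pair S) z / ?m (restrict (fst z) S) / ?m (restrict (snd z) S))
      = Q z * (ln (fibre_mass A Q (restrict_pair S) z)
         - (ln (?m (restrict (fst z) S)) + ln (?m (restrict (snd z) S))))"
    \<comment> \<open>Where \<open>Q z = 0\<close> both sides vanish; elsewhere every argument of
      \<open>ln\<close> is positive and the logarithm splits.\<close>
    proof (cases "Q z = 0")
      case False
      then have "fibre_mass A Q (restrict_pair S) z > 0"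
        using fibre_mass_pos[of A Q z] Q0 z finI by (fastforce simp: A_def)
      moreover have "?m (restrict (fst z) S) > 0" "?m (restrict (snd z) S) > 0"
        using z S by (auto simp: A_def intro!: marg restrict_in_states)
      ultimately show ?thesis by (simp add: ln_div ln_mult)
    qed simp
  qed
  finally show ?thesis .
qed

section \<open>Supermodularity for masses of product form\<close>

theorem lemma6p4:
  fixes d :: nat and X :: "nat \<Rightarrow> 'a set"
    and p :: "(nat \<Rightarrow> 'a) \<Rightarrow> real" and P :: "(nat \<Rightarrow> 'a) \<Rightarrow> (nat \<Rightarrow> 'a) \<Rightarrow> real"
  assumes "\<And>i. i \<in> {1..d} \<Longrightarrow> finite (X i)"
    and "pos_prob_mass (states X {1..d}) p"
    and "product_form d X p"
    and "transition_matrix (states X {1..d}) P"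
    and "stationary (states X {1..d}) p P"
  shows "supermodular {1..d}
    (\<lambda>S. KL_div (states X S) (marginal d X p S)
       (keep_in d X p P S) (keep_in d X p (stationary_matrix p) S))"
proof -
  let ?I = "{1..d}"
  let ?f = "\<lambda>S. KL_div (states X S) (marginal d X p S)
       (keep_in d X p P S) (keep_in d X p (stationary_matrix p) S)"
  define A where "A = states X ?I \<times> states X ?I"
  define Q where "Q = (\<lambda>(x, y). p x * P x y)"
  define E where "E S = (\<Sum>z\<in>A. Q z * ln (fibre_mass A Q (restrict_pair S) z))" for S
  obtain q where q: "\<And>i. i \<in> ?I \<Longrightarrow> prob_mass (X i) (q i)"
    and pq: "\<And>x. x \<in> states X ?I \<Longrightarrow> p x = (\<Prod>i\<in>?I. q i (x i))"
    using assms(3) unfolding product_form_def by blast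
  \<comment> \<open>The contribution of coordinate \<open>i\<close> to the logarithms of the two
    marginals, at both ends of the edge \<open>z\<close>.\<close>
  define L where "L z i = ln (q i (fst z i)) + ln (q i (snd z i))" for z i
  have finA: "finite A"
    unfolding A_def using finite_states[of ?I ?I X] assms(1) by auto
  have Q0: "Q z \<ge> 0" if "z \<in> A" for z
    using that assms(2,4)
    by (force simp: A_def Q_def pos_prob_mass_def transition_matrix_def prob_mass_def
        intro!: mult_nonneg_nonneg)
  \<comment> \<open>The factors \<open>q i\<close> are only known to be nonnegative, but a zero
    factor would make the positive mass \<open>p x\<close> vanish.\<close>
  have qpos: "q i (x i) > 0" if x: "x \<in> states X ?I" and i: "i \<in> ?I" for x i
  proof -
    have "(\<Prod>i\<in>?I. q i (x i)) \<noteq> 0"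
      using assms(2) x unfolding pos_prob_mass_def pq[OF x, symmetric] by force
    then have "q i (x i) \<noteq> 0" using i by (metis finite_atLeastAtMost prod_zero)
    moreover have "q i (x i) \<ge> 0"
      using q[OF i] x i by (auto simp: prob_mass_def states_def)
    ultimately show ?thesis by simp
  qed
  have f_eq: "?f S = E S - (\<Sum>z\<in>A. Q z * (\<Sum>i\<in>S. L z i))" if S: "S \<subseteq> ?I" for S
  proof -
    have mq: "marginal d X p S s = (\<Prod>i\<in>S. q i (s i))" if "s \<in> states X S" for s
      using assms(1) q pq S that by (rule marginal_product_form)
    have finS: "finite S" using S finite_subset by blast
    have nonempty: "states X ?I \<noteq> {}"
      using assms(2) by (force simp: pos_prob_mass_def prob_mass_def)
    \<comment> \<open>Since the total mass is 1, some full state \<open>x\<close> exists; it extends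
      \<open>s\<close> to a full state \<open>x'\<close>, where \<open>qpos\<close> applies.\<close>
    have marg: "marginal d X p S s > 0" if s: "s \<in> states X S" for s
    proof -
      obtain x where x: "x \<in> states X ?I" using nonempty by blast
      define x' where "x' = merge S (?I - S) (s, x)"
      have "x' \<in> states X ?I"
        using x s S by (auto simp: x'_def states_def merge_def PiE_def extensional_def Pi_def)
      then have "q i (s i) > 0" if "i \<in> S" for i
        using qpos[of x' i] that S by (auto simp: x'_def merge_def)
      then show ?thesis by (simp add: mq[OF s] prod_pos)
    qed
    have "?f S = (\<Sum>z\<in>A. Q z * (ln (fibre_mass A Q (restrict_pair S) z)
         - (ln (marginal d X p S (restrict (fst z) S)) + ln (marginal d X p S (restrict (snd z) S)))))"
      unfolding A_def Q_def by (rule KL_div_keep_in[OF assms(1,2,4) marg S])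
    also have "\<dots> = (\<Sum>z\<in>A. Q z * (ln (fibre_mass A Q (restrict_pair S) z) - (\<Sum>i\<in>S. L z i)))"
    proof (rule sum.cong[OF refl])
      fix z assume z: "z \<in> A"
      have ln_m: "ln (marginal d X p S (restrict x S)) = (\<Sum>i\<in>S. ln (q i (x i)))"
        if x: "x \<in> states X ?I" for x
      proof -
        have "ln (\<Prod>i\<in>S. q i (x i)) = (\<Sum>i\<in>S. ln (q i (x i)))"
          using finS S by (intro ln_prod) (use qpos[OF x] in fastforce)+
        then show ?thesis by (simp add: mq[OF restrict_in_states[OF x S]])
      qed
      show "Q z * (ln (fibre_mass A Q (restrict_pair S) z)
          - (ln (marginal d X p S (restrict (fst z) S)) + ln (marginal d X p S (restrict (snd z) S))))
        = Q z * (ln (fibre_mass A Q (restrict_pair S) z) - (\<Sum>i\<in>S. L z i))"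
        using z by (auto simp: A_def ln_m L_def sum.distrib)
    qed
    also have "\<dots> = E S - (\<Sum>z\<in>A. Q z * (\<Sum>i\<in>S. L z i))"
      by (simp add: E_def right_diff_distrib sum_subtractf)
    finally show ?thesis .
  qed
  have "?f S + ?f T \<le> ?f (S \<inter> T) + ?f (S \<union> T)" if S: "S \<subseteq> ?I" and T: "T \<subseteq> ?I" for S T
  proof -
    have fin: "finite S" "finite T" using S T finite_subset by blast+
    have "E S + E T \<le> E (S \<inter> T) + E (S \<union> T)"
      unfolding E_def
      \<comment> \<open>Here \<open>a\<close>, \<open>b\<close>, \<open>c\<close>, \<open>u\<close>
        are the restrictions to \<open>S\<close>, \<open>T\<close>, \<open>S \<inter> T\<close> and
        \<open>S \<union> T\<close>: the first two determine the last, and each of them determines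
        the third.\<close>
      by (rule entropy_submodular[OF finA Q0])
        (assumption | erule restrict_pair_Un restrict_pair_mono[OF Int_lower1]
          restrict_pair_mono[OF Int_lower2])+
    \<comment> \<open>A sum over the elements of a set is modular, so this part cancels from the
      inequality.\<close>
    moreover have "(\<Sum>z\<in>A. Q z * (\<Sum>i\<in>S. L z i)) + (\<Sum>z\<in>A. Q z * (\<Sum>i\<in>T. L z i))
      = (\<Sum>z\<in>A. Q z * (\<Sum>i\<in>S \<inter> T. L z i)) + (\<Sum>z\<in>A. Q z * (\<Sum>i\<in>S \<union> T. L z i))"
      unfolding sum.distrib[symmetric] distrib_left[symmetric]
      by (simp add: sum.union_inter[OF fin, symmetric] add.commute)
    moreover have "S \<inter> T \<subseteq> ?I" "S \<union> T \<subseteq> ?I" using S T by auto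
    ultimately show ?thesis
      by (simp only: f_eq[OF S] f_eq[OF T] f_eq)
  qed
  then show ?thesis
    unfolding supermodular_def submodular_def by (force simp: algebra_simps)
qed

end
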